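(* Let $\alpha\ge 0$, let $f\in D_\alpha$ satisfy $f(0)\neq 0$, and for each integer $n\ge 0$ let $p_n$ be the optimal approximant of order $n$ to $1/f$ in $D_\alpha$. Let $\mathcal{Z}(p_n)=\{z\in\mathbb{C}: p_n(z)=0\}$. Then $\mathcal{Z}(p_n)\cap\overline{\mathbb{D}}=\varnothing$ for all $n$.
   Context: $\mathbb{D}=\{z\in\mathbb{C}:|z|<1\}$ and $\overline{\mathbb{D}}$ is its closure. For $\alpha\in\mathbb{R}$, the Dirichlet-type space $D_\alpha$ consists of all analytic functions $f=\sum_{k\ge 0}a_kz^k$ on $\mathbb{D}$ with $\|f\|_\alpha^2=\sum_{k=0}^\infty (k+1)^\alpha|a_k|^2<\infty$; it is a Hilbert space with inner product $\langle f,g\rangle_\alpha=\sum_{k=0}^\infty (k+1)^\alpha a_k\overline{b_k}$ for $g=\sum_{k\ge0} b_kz^k$. Let $\mathcal{P}_n$ be the space of complex polynomials of degree at most $n$. For $f\in D_\alpha$, the optimal approximant of order $n$ to $1/f$ (in $D_\alpha$) is the unique $p_n\in\mathcal{P}_n$ minimizing $\|pf-1\|_\alpha$ over all $p\in\mathcal{P}_n$; equivalently, $p_nf$ is the orthogonal projection in $D_\alpha$ of the constant function $1$ onto $f\cdot\mathcal{P}_n=\{pf:p\in\mathcal{P}_n\}$. *)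

theory Defs
  imports "HOL-Complex_Analysis.Complex_Analysis" "HOL-Computational_Algebra.Polynomial"
begin

(* Functions on the unit disc are represented by functions on all of complex; only their
   values on ball 0 1 matter, since the Taylor coefficients at 0 depend on f near 0 only. *)

abbreviation taylor_coeff :: "(complex \<Rightarrow> complex) \<Rightarrow> nat \<Rightarrow> complex" where
  "taylor_coeff f k \<equiv> fps_nth (fps_expansion f 0) k"

definition dirichlet_space :: "real \<Rightarrow> (complex \<Rightarrow> complex) set" where
  "dirichlet_space \<alpha> =
     {f. f holomorphic_on ball 0 1 \<and>
         summable (\<lambda>k. (real k + 1) powr \<alpha> * (cmod (taylor_coeff f k))\<^sup>2)}"

(* Meaningful for members of dirichlet_space \<alpha> only: suminf is unspecified on
   divergent series. *)
definition dirichlet_norm :: "real \<Rightarrow> (complex \<Rightarrow> complex) \<Rightarrow> real" where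
  "dirichlet_norm \<alpha> f = sqrt (\<Sum>k. (real k + 1) powr \<alpha> * (cmod (taylor_coeff f k))\<^sup>2)"

(* For f in dirichlet_space \<alpha>, all the functions q f - 1 belong to dirichlet_space \<alpha>,
   since multiplication by z is bounded on it. If moreover f is not identically zero on the
   disc, exactly one p satisfies this predicate. *)
definition is_optimal_approximant ::
    "real \<Rightarrow> (complex \<Rightarrow> complex) \<Rightarrow> nat \<Rightarrow> complex poly \<Rightarrow> bool" where
  "is_optimal_approximant \<alpha> f n p \<longleftrightarrow>
     degree p \<le> n \<and>
     (\<forall>q. degree q \<le> n \<longrightarrow>
        dirichlet_norm \<alpha> (\<lambda>z. poly p z * f z - 1) \<le> dirichlet_norm \<alpha> (\<lambda>z. poly q z * f z - 1))"

end

(* If p_n (z0) = 0, write p_n = (z - z0) q and g = q f.  Perturbing p_n by multiples of z q shows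
   that (z - z0) g - 1 is orthogonal to z g; since z g vanishes at 0 it is orthogonal to 1, hence
   (z - z0) g is orthogonal to z g.  By Pythagoras,
     |z0|^2 ||g||^2 = ||(z - z0) g||^2 + ||z g||^2,
   while ||z g|| >= ||g|| because alpha >= 0.  So |z0| <= 1 forces (z - z0) g = 0, which contradicts
   p_n f \<noteq> 0.  Only the real part of the inner product is needed. *)
theory Submission
  imports Defs
begin

section \<open>Weighted square-summable sequences in a real inner product space\<close>

lemma summable_weighted_add:
  fixes x y :: "nat \<Rightarrow> 'a::real_inner"
  assumes w: "\<And>k. w k \<ge> 0"
    and x: "summable (\<lambda>k. w k * (norm (x k))\<^sup>2)" and y: "summable (\<lambda>k. w k * (norm (y k))\<^sup>2)"
  shows "summable (\<lambda>k. w k * (norm (x k + y k))\<^sup>2)"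
proof (rule summable_comparison_test')
  show "summable (\<lambda>k. 2 * (w k * (norm (x k))\<^sup>2 + w k * (norm (y k))\<^sup>2))"
    by (intro summable_mult summable_add x y)
next
  fix k
  \<comment> \<open>The parallelogram law; dropping the difference term leaves a bound by summable
    terms.\<close>
  have "(norm (x k + y k))\<^sup>2 + (norm (x k - y k))\<^sup>2 = 2 * ((norm (x k))\<^sup>2 + (norm (y k))\<^sup>2)"
    by (simp add: power2_norm_eq_inner inner_add inner_diff inner_commute)
  then have "(norm (x k + y k))\<^sup>2 \<le> 2 * ((norm (x k))\<^sup>2 + (norm (y k))\<^sup>2)"
    by (smt (verit) zero_le_power2)
  then have "w k * (norm (x k + y k))\<^sup>2 \<le> w k * (2 * ((norm (x k))\<^sup>2 + (norm (y k))\<^sup>2))"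
    by (rule mult_left_mono[OF _ w])
  then show "norm (w k * (norm (x k + y k))\<^sup>2)
      \<le> 2 * (w k * (norm (x k))\<^sup>2 + w k * (norm (y k))\<^sup>2)"
    using w[of k] by (simp add: algebra_simps)
qed

text \<open>By polarization, each term is a combination of three summable weighted squares.\<close>

lemma summable_weighted_inner:
  fixes x y :: "nat \<Rightarrow> 'a::real_inner"
  assumes w: "\<And>k. w k \<ge> 0"
    and x: "summable (\<lambda>k. w k * (norm (x k))\<^sup>2)" and y: "summable (\<lambda>k. w k * (norm (y k))\<^sup>2)"
  shows "summable (\<lambda>k. w k * (x k \<bullet> y k))"
proof -
  have "w k * (x k \<bullet> y k)
      = (w k * (norm (x k + y k))\<^sup>2 - w k * (norm (x k))\<^sup>2 - w k * (norm (y k))\<^sup>2) / 2" for k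
    by (simp add: power2_norm_eq_inner inner_add inner_commute field_simps)
  then show ?thesis
    by (simp only: summable_divide summable_diff summable_weighted_add assms)
qed

lemma weighted_square_expansion:
  fixes x y :: "nat \<Rightarrow> 'a::real_inner"
  assumes w: "\<And>k. w k \<ge> 0"
    and x: "summable (\<lambda>k. w k * (norm (x k))\<^sup>2)" and y: "summable (\<lambda>k. w k * (norm (y k))\<^sup>2)"
  shows "(\<Sum>k. w k * (norm (x k + t *\<^sub>R y k))\<^sup>2)
    = (\<Sum>k. w k * (norm (x k))\<^sup>2) + 2 * t * (\<Sum>k. w k * (x k \<bullet> y k))
      + t\<^sup>2 * (\<Sum>k. w k * (norm (y k))\<^sup>2)"
proof -
  have "(\<lambda>k. w k * (norm (x k))\<^sup>2 + 2 * t * (w k * (x k \<bullet> y k)) + t\<^sup>2 * (w k * (norm (y k))\<^sup>2))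
    sums ((\<Sum>k. w k * (norm (x k))\<^sup>2) + 2 * t * (\<Sum>k. w k * (x k \<bullet> y k))
      + t\<^sup>2 * (\<Sum>k. w k * (norm (y k))\<^sup>2))"
    by (intro sums_add sums_mult summable_sums summable_weighted_inner assms)
  moreover have "w k * (norm (x k + t *\<^sub>R y k))\<^sup>2
      = w k * (norm (x k))\<^sup>2 + 2 * t * (w k * (x k \<bullet> y k)) + t\<^sup>2 * (w k * (norm (y k))\<^sup>2)" for k
    unfolding power2_norm_eq_inner
    by (simp add: inner_add inner_commute power2_eq_square algebra_simps)
  ultimately have "(\<lambda>k. w k * (norm (x k + t *\<^sub>R y k))\<^sup>2) sums
      ((\<Sum>k. w k * (norm (x k))\<^sup>2) + 2 * t * (\<Sum>k. w k * (x k \<bullet> y k))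
        + t\<^sup>2 * (\<Sum>k. w k * (norm (y k))\<^sup>2))"
    by (simp only:)
  then show ?thesis
    by (rule sums_unique[symmetric])
qed

lemma linear_term_zero:
  fixes b c :: real
  assumes "\<And>t. 2 * t * b + t\<^sup>2 * c \<ge> 0"
  shows "b = 0"
proof (rule ccontr)
  assume "b \<noteq> 0"
  \<comment> \<open>The vertex of the parabola would be \<open>- b / c\<close>. The denominator |c|
    + 1 is positive for every real \<open>c\<close> and large enough that the linear term still
    dominates, so the value at \<open>s\<close> is negative.\<close>
  define s where "s = - b / (\<bar>c\<bar> + 1)"
  have b: "b = - s * (\<bar>c\<bar> + 1)" and "s \<noteq> 0"
    using \<open>b \<noteq> 0\<close> by (auto simp: s_def)
  have "2 * s * b + s\<^sup>2 * c = s\<^sup>2 * (c - 2 * \<bar>c\<bar> - 2)"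
    unfolding b by (simp add: power2_eq_square algebra_simps)
  also have "\<dots> < 0"
    using \<open>s \<noteq> 0\<close> by (intro mult_pos_neg) auto
  finally show False
    using assms[of s] by simp
qed

text \<open>First-order condition: along the line through \<open>x\<close> in direction
  \<open>y\<close>, the increase of the squared norm is a quadratic in \<open>t\<close> without
  constant term. Being nonnegative for all real \<open>t\<close>, it has no linear term.\<close>

lemma weighted_minimum_orthogonal:
  fixes x y :: "nat \<Rightarrow> 'a::real_inner"
  assumes w: "\<And>k. w k \<ge> 0"
    and x: "summable (\<lambda>k. w k * (norm (x k))\<^sup>2)" and y: "summable (\<lambda>k. w k * (norm (y k))\<^sup>2)"
    and min: "\<And>t. (\<Sum>k. w k * (norm (x k))\<^sup>2) \<le> (\<Sum>k. w k * (norm (x k + t *\<^sub>R y k))\<^sup>2)"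
  shows "(\<Sum>k. w k * (x k \<bullet> y k)) = 0"
  using min unfolding weighted_square_expansion[OF w x y]
  by (intro linear_term_zero[where c = "\<Sum>k. w k * (norm (y k))\<^sup>2"]) (simp add: algebra_simps)

section \<open>Dirichlet spaces as spaces of formal power series\<close>

lemma has_fps_expansion_poly [fps_expansion_intros]:
  fixes p :: "'a::{banach, real_normed_field} poly"
  shows "poly p has_fps_expansion fps_of_poly p"
proof (induction p)
  case 0
  then show ?case using has_fps_expansion_0 by simp
next
  case (pCons a p)
  have "(\<lambda>z. a + z * poly p z) has_fps_expansion fps_const a + fps_X * fps_of_poly p"
    by (intro fps_expansion_intros pCons.IH)
  then show ?case
    by (simp add: fps_of_poly_pCons algebra_simps)
qed

abbreviation dirichlet_weight :: "real \<Rightarrow> nat \<Rightarrow> real" where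
  "dirichlet_weight \<alpha> k \<equiv> (real k + 1) powr \<alpha>"

text \<open>The coefficient side of the Dirichlet space. Norms and orthogonality depend on Taylor
  coefficients only, so products with polynomials can be handled algebraically, without reference to
  holomorphy.\<close>

definition dirichlet_fps :: "real \<Rightarrow> complex fps set" where
  "dirichlet_fps \<alpha> = {A. summable (\<lambda>k. dirichlet_weight \<alpha> k * (norm (fps_nth A k))\<^sup>2)}"

lemma dirichlet_fps_add:
  "A \<in> dirichlet_fps \<alpha> \<Longrightarrow> B \<in> dirichlet_fps \<alpha> \<Longrightarrow> A + B \<in> dirichlet_fps \<alpha>"
  by (auto simp: dirichlet_fps_def intro!: summable_weighted_add)

lemma dirichlet_fps_const_mult:
  assumes "A \<in> dirichlet_fps \<alpha>"
  shows "fps_const c * A \<in> dirichlet_fps \<alpha>"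
proof -
  have "dirichlet_weight \<alpha> k * (norm (fps_nth (fps_const c * A) k))\<^sup>2
      = (norm c)\<^sup>2 * (dirichlet_weight \<alpha> k * (norm (fps_nth A k))\<^sup>2)" for k
    by (simp add: norm_mult power_mult_distrib)
  then show ?thesis
    using assms unfolding dirichlet_fps_def by (simp only: mem_Collect_eq summable_mult)
qed

lemma dirichlet_fps_X_mult:
  assumes "\<alpha> \<ge> 0" "A \<in> dirichlet_fps \<alpha>"
  shows "fps_X * A \<in> dirichlet_fps \<alpha>"
proof -
  have "summable (\<lambda>k. dirichlet_weight \<alpha> (Suc k) * (norm (fps_nth (fps_X * A) (Suc k)))\<^sup>2)"
  proof (rule summable_comparison_test')
    show "summable (\<lambda>k. 2 powr \<alpha> * (dirichlet_weight \<alpha> k * (norm (fps_nth A k))\<^sup>2))"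
      using assms(2) by (auto simp: dirichlet_fps_def intro!: summable_mult)
  next
    fix k
    \<comment> \<open>Since k + 2 \<le> 2 (k + 1), the shift enlarges each weight by a factor of at
      most \<open>2 powr \<alpha>\<close>.\<close>
    have "dirichlet_weight \<alpha> (Suc k) \<le> (2 * (real k + 1)) powr \<alpha>"
      using assms(1) by (intro powr_mono2) auto
    also have "\<dots> = 2 powr \<alpha> * dirichlet_weight \<alpha> k"
      by (rule powr_mult)
    finally show "norm (dirichlet_weight \<alpha> (Suc k) * (norm (fps_nth (fps_X * A) (Suc k)))\<^sup>2)
        \<le> 2 powr \<alpha> * (dirichlet_weight \<alpha> k * (norm (fps_nth A k))\<^sup>2)"
      by (simp add: mult.assoc[symmetric] mult_right_mono)
  qed
  then show ?thesis
    unfolding dirichlet_fps_def mem_Collect_eq by (subst (asm) summable_Suc_iff)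
qed

text \<open>Horner's scheme reduces multiplication by a polynomial to scalar multiples, sums and the
  shift \<open>fps_X\<close>.\<close>

lemma dirichlet_fps_poly_mult:
  assumes "\<alpha> \<ge> 0" "A \<in> dirichlet_fps \<alpha>"
  shows "fps_of_poly p * A \<in> dirichlet_fps \<alpha>"
proof (induction p)
  case 0
  then show ?case by (simp add: dirichlet_fps_def)
next
  case (pCons a p)
  have "fps_of_poly (pCons a p) * A = fps_const a * A + fps_X * (fps_of_poly p * A)"
    by (simp add: fps_of_poly_pCons algebra_simps)
  then show ?case
    using assms pCons.IH by (simp add: dirichlet_fps_add dirichlet_fps_const_mult dirichlet_fps_X_mult)
qed

lemma dirichlet_fps_minus_one:
  assumes "A \<in> dirichlet_fps \<alpha>"
  shows "A - 1 \<in> dirichlet_fps \<alpha>"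
proof -
  have "summable (\<lambda>k. dirichlet_weight \<alpha> k * (norm (fps_nth (-1 :: complex fps) k))\<^sup>2)"
    by (rule summable_finite[of "{0}"]) auto
  then have "A + - 1 \<in> dirichlet_fps \<alpha>"
    by (intro dirichlet_fps_add assms) (simp add: dirichlet_fps_def)
  then show ?thesis by simp
qed

text \<open>The shift moves coefficient k to index k + 1, where the weight is at least as large
  because \<alpha> \<ge> 0.\<close>

lemma suminf_dirichlet_le_X_mult:
  assumes "\<alpha> \<ge> 0" "A \<in> dirichlet_fps \<alpha>"
  shows "(\<Sum>k. dirichlet_weight \<alpha> k * (norm (fps_nth A k))\<^sup>2)
    \<le> (\<Sum>k. dirichlet_weight \<alpha> k * (norm (fps_nth (fps_X * A) k))\<^sup>2)"
proof -
  let ?v = "\<lambda>k. dirichlet_weight \<alpha> k * (norm (fps_nth (fps_X * A) k))\<^sup>2"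
  have v: "summable ?v"
    using dirichlet_fps_X_mult[OF assms] by (simp add: dirichlet_fps_def)
  have "(\<Sum>k. dirichlet_weight \<alpha> k * (norm (fps_nth A k))\<^sup>2) \<le> (\<Sum>k. ?v (Suc k))"
  proof (rule suminf_le)
    show "dirichlet_weight \<alpha> k * (norm (fps_nth A k))\<^sup>2 \<le> ?v (Suc k)" for k
      using assms(1) by (auto intro!: mult_right_mono powr_mono2)
    show "summable (\<lambda>k. dirichlet_weight \<alpha> k * (norm (fps_nth A k))\<^sup>2)"
      using assms(2) by (simp add: dirichlet_fps_def)
    show "summable (\<lambda>k. ?v (Suc k))"
      using v by (subst summable_Suc_iff)
  qed
  \<comment> \<open>The term at index 0 vanishes, as \<open>fps_X * A\<close> has no constant
    term.\<close>
  also have "\<dots> = (\<Sum>k. ?v k)"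
    using suminf_split_head[OF v] by simp
  finally show ?thesis .
qed

lemma dirichlet_fps_eq_zero:
  assumes "A \<in> dirichlet_fps \<alpha>"
    and "(\<Sum>k. dirichlet_weight \<alpha> k * (norm (fps_nth A k))\<^sup>2) \<le> 0"
  shows "A = 0"
proof -
  have s: "summable (\<lambda>k. dirichlet_weight \<alpha> k * (norm (fps_nth A k))\<^sup>2)"
    using assms(1) by (simp add: dirichlet_fps_def)
  then have "(\<Sum>k. dirichlet_weight \<alpha> k * (norm (fps_nth A k))\<^sup>2) = 0"
    using assms(2) by (intro antisym suminf_nonneg) auto
  then have "\<forall>k. dirichlet_weight \<alpha> k * (norm (fps_nth A k))\<^sup>2 = 0"
    using suminf_eq_zero_iff[OF s] by simp
  \<comment> \<open>A weight could vanish only if its base \<open>real k + 1\<close> were 0, so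
    every coefficient is 0.\<close>
  then show ?thesis
    by (simp add: fps_eq_iff add_nonneg_eq_0_iff)
qed

text \<open>The boundary case of \<open>z\<close> on the unit circle is included: the estimate need
  only give a norm of at most 0 for \<open>(fps_X - fps_const z) * G\<close>, and the absence of
  zero divisors then yields the contradiction.\<close>

lemma X_minus_const_mult_not_orthogonal:
  fixes G :: "complex fps"
  assumes \<alpha>: "\<alpha> \<ge> 0" and G: "G \<in> dirichlet_fps \<alpha>" "G \<noteq> 0" and z: "norm z \<le> 1"
  shows "(\<Sum>k. dirichlet_weight \<alpha> k
    * (fps_nth ((fps_X - fps_const z) * G) k \<bullet> fps_nth (fps_X * G) k)) \<noteq> 0"
proof
  define U V where "U = (fps_X - fps_const z) * G" and "V = fps_X * G"
  let ?N = "\<lambda>A. \<Sum>k. dirichlet_weight \<alpha> k * (norm (fps_nth A k))\<^sup>2"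
  assume "(\<Sum>k. dirichlet_weight \<alpha> k
    * (fps_nth ((fps_X - fps_const z) * G) k \<bullet> fps_nth (fps_X * G) k)) = 0"
  then have orth: "(\<Sum>k. dirichlet_weight \<alpha> k * (fps_nth U k \<bullet> fps_nth V k)) = 0"
    by (simp add: U_def V_def)
  have V: "V \<in> dirichlet_fps \<alpha>"
    unfolding V_def by (rule dirichlet_fps_X_mult[OF \<alpha> G(1)])
  have U_eq: "U = V + fps_const (- z) * G"
    by (simp add: U_def V_def algebra_simps flip: fps_const_neg)
  have U: "U \<in> dirichlet_fps \<alpha>"
    unfolding U_eq by (intro dirichlet_fps_add dirichlet_fps_const_mult V G)
  \<comment> \<open>Pythagoras: the square expansion at t = -1 loses its cross term by
    orthogonality, and U - V is the series -z G.\<close>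
  have "?N U + ?N V = (\<Sum>k. dirichlet_weight \<alpha> k * (norm (fps_nth U k + (-1) *\<^sub>R fps_nth V k))\<^sup>2)"
    using U V orth by (subst weighted_square_expansion) (auto simp: dirichlet_fps_def)
  also have "\<dots> = (\<Sum>k. (norm z)\<^sup>2 * (dirichlet_weight \<alpha> k * (norm (fps_nth G k))\<^sup>2))"
    unfolding U_eq by (simp add: norm_mult power_mult_distrib algebra_simps)
  also have "\<dots> = (norm z)\<^sup>2 * ?N G"
    using G by (intro suminf_mult) (simp add: dirichlet_fps_def)
  also have "\<dots> \<le> 1 * ?N G"
    using G z by (intro mult_right_mono suminf_nonneg power_le_one) (auto simp: dirichlet_fps_def)
  also have "\<dots> \<le> ?N V"
    unfolding V_def using suminf_dirichlet_le_X_mult[OF \<alpha> G(1)] by simp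
  finally have "U = 0"
    by (intro dirichlet_fps_eq_zero[OF U]) simp
  \<comment> \<open>Its coefficient at index 1 is 1, so \<open>U = 0\<close> would force
    \<open>G = 0\<close>.\<close>
  moreover have "fps_X - fps_const z \<noteq> 0"
  proof
    assume "fps_X - fps_const z = 0"
    then have "fps_nth (fps_X - fps_const z) 1 = 0" by simp
    then show False by simp
  qed
  ultimately show False
    using G(2) by (simp add: U_def)
qed

section \<open>Orthogonality relations of the optimal approximant\<close>

text \<open>The perturbations p + t r keep degree at most \<open>n\<close>, so \<open>p\<close> is
  minimal along this line. Real \<open>t\<close> suffices and gives the vanishing of the real part
  of the Hermitian product, which is what \<open>\<bullet>\<close> means on complex numbers.\<close>

lemma optimal_approximant_orthogonal:
  assumes \<alpha>: "\<alpha> \<ge> 0" and f: "f \<in> dirichlet_space \<alpha>"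
    and opt: "is_optimal_approximant \<alpha> f n p" and r: "degree r \<le> n"
  defines "F \<equiv> fps_expansion f 0"
  shows "(\<Sum>k. dirichlet_weight \<alpha> k
    * (fps_nth (fps_of_poly p * F - 1) k \<bullet> fps_nth (fps_of_poly r * F) k)) = 0"
proof (rule weighted_minimum_orthogonal)
  have F: "F \<in> dirichlet_fps \<alpha>"
    using f by (simp add: dirichlet_space_def dirichlet_fps_def F_def)
  show "summable (\<lambda>k. dirichlet_weight \<alpha> k * (norm (fps_nth (fps_of_poly p * F - 1) k))\<^sup>2)"
    using dirichlet_fps_minus_one[OF dirichlet_fps_poly_mult[OF \<alpha> F]]
    by (simp add: dirichlet_fps_def)
  show "summable (\<lambda>k. dirichlet_weight \<alpha> k * (norm (fps_nth (fps_of_poly r * F) k))\<^sup>2)"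
    using dirichlet_fps_poly_mult[OF \<alpha> F] by (simp add: dirichlet_fps_def)
  have "f has_fps_expansion F"
    unfolding F_def using f by (intro has_fps_expansion_fps_expansion[of "ball 0 1"])
      (auto simp: dirichlet_space_def)
  \<comment> \<open>The passage from functions to series: by uniqueness of the expansion at 0, the
    norm of q f - 1 is read off from the coefficients of the product series.\<close>
  then have expansion: "fps_expansion (\<lambda>z. poly q z * f z - 1) 0 = fps_of_poly q * F - 1" for q
    by (intro fps_expansion_eqI fps_expansion_intros)
  fix t :: real
  define q where "q = p + smult (of_real t) r"
  have "degree q \<le> n"
    using opt r unfolding q_def is_optimal_approximant_def
    by (intro degree_add_le order.trans[OF degree_smult_le]) auto
  then have "dirichlet_norm \<alpha> (\<lambda>z. poly p z * f z - 1) \<le> dirichlet_norm \<alpha> (\<lambda>z. poly q z * f z - 1)"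
    using opt by (simp add: is_optimal_approximant_def)
  moreover have "fps_nth (fps_of_poly q * F - 1) k
      = fps_nth (fps_of_poly p * F - 1) k + t *\<^sub>R fps_nth (fps_of_poly r * F) k" for k
    by (simp add: q_def fps_of_poly_add fps_of_poly_smult scaleR_conv_of_real distrib_right mult.assoc)
  ultimately show "(\<Sum>k. dirichlet_weight \<alpha> k * (norm (fps_nth (fps_of_poly p * F - 1) k))\<^sup>2)
    \<le> (\<Sum>k. dirichlet_weight \<alpha> k
      * (norm (fps_nth (fps_of_poly p * F - 1) k + t *\<^sub>R fps_nth (fps_of_poly r * F) k))\<^sup>2)"
    unfolding dirichlet_norm_def expansion real_sqrt_le_iff by (simp only:)
\<comment> \<open>What remains is the nonnegativity of the weight.\<close>
qed simp

lemma suminf_dirichlet_minus_one_inner: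
  assumes A: "A \<in> dirichlet_fps \<alpha>" and B: "B \<in> dirichlet_fps \<alpha>"
  shows "(\<Sum>k. dirichlet_weight \<alpha> k * (fps_nth (A - 1) k \<bullet> fps_nth B k))
    = (\<Sum>k. dirichlet_weight \<alpha> k * (fps_nth A k \<bullet> fps_nth B k)) - Re (fps_nth B 0)"
proof -
  have "(\<lambda>k. dirichlet_weight \<alpha> k * (fps_nth A k \<bullet> fps_nth B k)) sums
      (\<Sum>k. dirichlet_weight \<alpha> k * (fps_nth A k \<bullet> fps_nth B k))"
    using A B by (intro summable_sums summable_weighted_inner) (auto simp: dirichlet_fps_def)
  moreover have "(\<lambda>k. dirichlet_weight \<alpha> k * (fps_nth 1 k \<bullet> fps_nth B k)) sums Re (fps_nth B 0)"
    using sums_finite[of "{0}" "\<lambda>k. dirichlet_weight \<alpha> k * (fps_nth 1 k \<bullet> fps_nth B k)"]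
    by (simp add: inner_complex_def)
  ultimately have "(\<lambda>k. dirichlet_weight \<alpha> k * (fps_nth A k \<bullet> fps_nth B k)
      - dirichlet_weight \<alpha> k * (fps_nth 1 k \<bullet> fps_nth B k)) sums
      ((\<Sum>k. dirichlet_weight \<alpha> k * (fps_nth A k \<bullet> fps_nth B k)) - Re (fps_nth B 0))"
    by (rule sums_diff)
  then show ?thesis
    by (simp only: fps_sub_nth inner_diff_left right_diff_distrib sums_unique[symmetric])
qed

text \<open>If \<open>p\<close> were 0, then -1 would be orthogonal to every admissible multiple of
  \<open>f\<close>. The constant multiplier \<open>1 / f 0\<close>, admissible for each
  \<open>n\<close>, gives a series with constant coefficient 1, and the product is -1 instead of
  0.\<close>

lemma optimal_approximant_nonzero:
  assumes \<alpha>: "\<alpha> \<ge> 0" and f: "f \<in> dirichlet_space \<alpha>" "f 0 \<noteq> 0"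
    and opt: "is_optimal_approximant \<alpha> f n p"
  shows "p \<noteq> 0"
proof
  define F where "F = fps_expansion f 0"
  assume "p = 0"
  have F: "F \<in> dirichlet_fps \<alpha>"
    using f by (simp add: dirichlet_space_def dirichlet_fps_def F_def)
  have "0 \<in> dirichlet_fps \<alpha>"
    by (simp add: dirichlet_fps_def)
  from suminf_dirichlet_minus_one_inner[OF this dirichlet_fps_poly_mult[OF \<alpha> F]]
  have "(\<Sum>k. dirichlet_weight \<alpha> k
      * (fps_nth (fps_of_poly p * F - 1) k \<bullet> fps_nth (fps_of_poly [:1 / f 0:] * F) k))
    = - Re (fps_nth (fps_of_poly [:1 / f 0:] * F) 0)"
    by (simp only: \<open>p = 0\<close> fps_of_poly_0 mult_zero_left fps_zero_nth inner_zero_left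
        mult_zero_right suminf_zero diff_0)
  also have "fps_nth (fps_of_poly [:1 / f 0:] * F) 0 = 1"
    using f(2) by (simp add: F_def fps_of_poly_const fps_expansion_def)
  finally show False
    using optimal_approximant_orthogonal[OF \<alpha> f(1) opt, of "[:1 / f 0:]"]
    by (simp add: F_def[symmetric])
qed

section \<open>Absence of zeros in the closed disc\<close>

theorem theoremA:
  fixes \<alpha> :: real and f :: "complex \<Rightarrow> complex" and p :: "nat \<Rightarrow> complex poly"
  assumes "\<alpha> \<ge> 0"
    and "f \<in> dirichlet_space \<alpha>"
    and "f 0 \<noteq> 0"
    and "\<And>n. is_optimal_approximant \<alpha> f n (p n)"
  shows "\<forall>n. {z. poly (p n) z = 0} \<inter> closure (ball 0 1) = {}"
proof (intro allI equals0I)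
  fix n z
  assume "z \<in> {z. poly (p n) z = 0} \<inter> closure (ball 0 1)"
  then have root: "poly (p n) z = 0" and z: "norm z \<le> 1"
    by auto
  define F where "F = fps_expansion f 0"
  have F: "F \<in> dirichlet_fps \<alpha>"
    using assms(2) by (simp add: dirichlet_space_def dirichlet_fps_def F_def)
  have "fps_nth F 0 \<noteq> 0"
    using assms(3) by (simp add: F_def fps_expansion_def)
  then have "F \<noteq> 0" by auto
  obtain q where pq: "p n = [:- z, 1:] * q"
    using root by (auto simp: poly_eq_0_iff_dvd)
  have "p n \<noteq> 0"
    by (rule optimal_approximant_nonzero[OF assms])
  then have "q \<noteq> 0" using pq by auto
  define G where "G = fps_of_poly q * F"
  have G: "G \<in> dirichlet_fps \<alpha>"
    unfolding G_def by (rule dirichlet_fps_poly_mult[OF assms(1) F])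
  have "fps_of_poly q \<noteq> 0"
    using \<open>q \<noteq> 0\<close> fps_of_poly_eq_iff[of q 0] by simp
  then have "G \<noteq> 0"
    using \<open>F \<noteq> 0\<close> by (simp add: G_def)
  have "degree (p n) = Suc (degree q)"
    unfolding pq using \<open>q \<noteq> 0\<close> by (subst degree_mult_eq) auto
  moreover have "degree (p n) \<le> n"
    using assms(4)[of n] by (simp add: is_optimal_approximant_def)
  \<comment> \<open>Replacing the factor with root \<open>z\<close> by the monomial keeps the
    degree, so \<open>pCons 0 q\<close> is an admissible direction of perturbation.\<close>
  ultimately have deg: "degree (pCons 0 q) \<le> n"
    using \<open>q \<noteq> 0\<close> by simp
  have pF: "fps_of_poly (p n) * F = (fps_X - fps_const z) * G"
    by (simp add: pq fps_of_poly_mult fps_of_poly_linear G_def mult.assoc flip: fps_const_neg del: mult_pCons_left)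
  have rF: "fps_of_poly (pCons 0 q) * F = fps_X * G"
    by (simp add: fps_of_poly_pCons G_def algebra_simps)
  \<comment> \<open>Orthogonality of p f - 1 to \<open>fps_X * G\<close>, with the contribution of 1
    equal to 0 because \<open>fps_X * G\<close> has no constant term.\<close>
  have "(\<Sum>k. dirichlet_weight \<alpha> k
      * (fps_nth ((fps_X - fps_const z) * G) k \<bullet> fps_nth (fps_X * G) k)) = 0"
    using optimal_approximant_orthogonal[OF assms(1,2,4) deg]
      suminf_dirichlet_minus_one_inner[OF dirichlet_fps_poly_mult[OF assms(1) F, of "p n"]
        dirichlet_fps_X_mult[OF assms(1) G]]
    unfolding F_def[symmetric] pF rF by simp
  then show False
    using X_minus_const_mult_not_orthogonal[OF assms(1) G \<open>G \<noteq> 0\<close> z] by contradiction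
qed

end
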